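(* Let $m\ge 2$, let $h_\omega$ be the infinite $m$-bonacci word and let $(z_n)_{n\ge 0}=(z_n^{(m)})_{n\ge 0}$ be the sequence of words defined in the context. The closed $z$-factorization of $h_\omega$ is $$cz(h_\omega)=(z_0,\,z_1,\,z_2,\,z_3,\,\ldots).$$
   Context: Fix $m\ge 2$ and $A_m=\{0,1,\ldots,m-1\}$. The morphism $\varphi_m:A_m^*\to A_m^*$ is given by $\varphi_m(i)=0(i+1)$ for $0\le i\le m-2$ and $\varphi_m(m-1)=0$. Put $h_n=\varphi_m^n(0)$ for $n\ge 0$; the infinite $m$-bonacci word $h_\omega$ is the fixed point of $\varphi_m$ starting with $0$. $w^R$ is the reversal of a word $w$. If $w=uv$ then $u^{-1}w=v$ and $wv^{-1}=u$. For an integer $n$, $\underline{n}$ is the letter $n \bmod m\in\{0,\ldots,m-1\}$. The words $z_n$: $z_0=0$, $z_1=1$; $z_2=020$ if $m\ge 3$ and $z_2=00$ if $m=2$. If $m=2$, then for $n\ge 3$, $z_n=(\underline{n-3})^{-1}h_{n-3}^R\,h_{n-2}^R\,\underline{n-2}$. If $m\ge 3$, then for $3\le n\le m-1$, $$z_n=(n-3)^{-1}h_{n-3}^R\,h_{n-2}^R\,n\,h_0^Rh_1^R\cdots h_{n-3}^R\,(n-2)$$ (where $n$, $n-2$, $n-3$ denote letters), and for $n\ge \max(3,m)$, $$z_n=(\underline{n-3})^{-1}h_{n-3}^R\,h_{n-2}^R\,h_{n-m}^Rh_{n-m+1}^R\cdots h_{n-3}^R\,\underline{n-2}.$$ A word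 $x$ is a border of $w$ if it is nonempty and both a prefix and a suffix of $w$. A nonempty finite word $w$ is closed if it is a single letter or it has a border $x$ that occurs exactly twice in $w$ (occurrences may overlap). The closed $z$-factorization of an infinite word $\boldsymbol w$ is the factorization $cz(\boldsymbol w)=(y_0,y_1,\ldots)$ with $\boldsymbol w=y_0y_1\cdots$, where for each $i$, $y_i$ is the shortest closed prefix of $y_iy_{i+1}\cdots$ that occurs exactly once in $y_0y_1\cdots y_i$. *)

theory Defs
  imports Main "HOL-Library.Stream" "HOL-Library.Sublist"
begin

section \<open>Finite words\<close>

text \<open>The quotient \<open>u\<^sup>-\<^sup>1 w\<close>: the \<open>v\<close> with \<open>w = u v\<close>; meaningful only if \<open>u\<close> is a prefix of \<open>w\<close>.\<close>

definition left_quotient :: "'a list \<Rightarrow> 'a list \<Rightarrow> 'a list" where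
  "left_quotient u w = (THE v. w = u @ v)"

lemma left_quotient_append [simp]: "left_quotient u (u @ v) = v"
  by (simp add: left_quotient_def)

text \<open>Number of (possibly overlapping) occurrences of \<open>x\<close> in \<open>w\<close>.\<close>

definition occurrences :: "'a list \<Rightarrow> 'a list \<Rightarrow> nat" where
  "occurrences x w = card {(u, v). w = u @ x @ v}"

definition border :: "'a list \<Rightarrow> 'a list \<Rightarrow> bool" where
  "border x w \<longleftrightarrow> x \<noteq> [] \<and> prefix x w \<and> suffix x w"

definition closed_word :: "'a list \<Rightarrow> bool" where
  "closed_word w \<longleftrightarrow> w \<noteq> [] \<and> (length w = 1 \<or> (\<exists>x. border x w \<and> occurrences x w = 2))"


section \<open>The closed z-factorization of an infinite word\<close>

definition stream_prefix :: "'a list \<Rightarrow> 'a stream \<Rightarrow> bool" where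
  "stream_prefix x s \<longleftrightarrow> (\<exists>t. s = x @- t)"

text \<open>The infinite product \<open>y\<^sub>i y\<^sub>i\<^sub>+\<^sub>1 \<cdots>\<close> (of nonempty words).\<close>

definition product_from :: "nat \<Rightarrow> (nat \<Rightarrow> 'a list) \<Rightarrow> 'a stream" where
  "product_from i y = flat (smap y (fromN i))"

text \<open>
  A candidate \<open>x\<close> for the \<open>i\<close>-th factor has to occur exactly once in
  \<open>y\<^sub>0 \<cdots> y\<^sub>i\<^sub>-\<^sub>1 x\<close>, that is, only as its last factor.
\<close>

definition closed_z_factorization :: "'a stream \<Rightarrow> (nat \<Rightarrow> 'a list) \<Rightarrow> bool" where
  "closed_z_factorization w y \<longleftrightarrow>
     (\<forall>i. y i \<noteq> []) \<and> w = product_from 0 y \<and>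
     (\<forall>i. is_arg_min length
            (\<lambda>x. stream_prefix x (product_from i y) \<and> closed_word x \<and>
                 occurrences x (concat (map y [0..<i]) @ x) = 1)
            (y i))"

lemma product_from_rec:
  assumes "y i \<noteq> []"
  shows "product_from i y = y i @- product_from (Suc i) y"
  using assms by (simp add: product_from_def flat_unfold)

lemma product_from_0:
  assumes "\<And>i. y i \<noteq> []"
  shows "product_from 0 y = concat (map y [0..<n]) @- product_from n y"
proof (induction n)
  case (Suc n)
  then show ?case
    using product_from_rec[of y n, OF assms] by (simp add: shift_append)
qed simp

lemma shift_cancel: "length x = length y \<Longrightarrow> x @- s = y @- t \<Longrightarrow> x = y \<and> s = t"
  by (induction x y rule: list_induct2) auto

lemma closed_z_factorization_unique:
  assumes y: "closed_z_factorization w y" and y': "closed_z_factorization w y'"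
  shows "y = y'"
proof
  fix i
  show "y i = y' i"
  proof (induction i rule: less_induct)
    case (less i)
    define p where "p = concat (map y [0..<i])"
    have p': "p = concat (map y' [0..<i])"
      unfolding p_def using less by (intro arg_cong[of _ _ concat] map_cong) auto
    have ne: "y i \<noteq> []" "y' i \<noteq> []" for i
      using y y' unfolding closed_z_factorization_def by blast+
    have w: "w = product_from 0 y" "w = product_from 0 y'"
      using y y' unfolding closed_z_factorization_def by blast+
    have "w = p @- product_from i y"
      unfolding p_def w(1) by (rule product_from_0[OF ne(1)])
    moreover have "w = p @- product_from i y'"
      unfolding p' w(2) by (rule product_from_0[OF ne(2)])
    ultimately have s: "product_from i y = product_from i y'"
      using shift_cancel[of p p] by blast
    let ?P = "\<lambda>x. stream_prefix x (product_from i y) \<and> closed_word x \<and>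
                 occurrences x (p @ x) = 1"
    have "is_arg_min length ?P (y i)"
      using y unfolding closed_z_factorization_def p_def by blast
    moreover have "is_arg_min length ?P (y' i)"
      using y' unfolding closed_z_factorization_def s p' by blast
    ultimately have len: "length (y i) = length (y' i)"
      unfolding is_arg_min_def by (metis linorder_neqE_nat)
    show ?case
      using shift_cancel[OF len] product_from_rec[of y i, OF ne(1)]
        product_from_rec[of y' i, OF ne(2)] s by metis
  qed
qed


section \<open>The infinite m-bonacci word\<close>

text \<open>
  The alphabet is \<open>{0..<m}\<close>. The values of \<open>bonacci_letter m\<close> on letters outside the
  alphabet are irrelevant.
\<close>

definition bonacci_letter :: "nat \<Rightarrow> nat \<Rightarrow> nat list" where
  "bonacci_letter m i = (if i + 1 < m then [0, i + 1] else [0])"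

definition bonacci_morphism :: "nat \<Rightarrow> nat list \<Rightarrow> nat list" where
  "bonacci_morphism m w = concat (map (bonacci_letter m) w)"

text \<open>The extension of the morphism to infinite words.\<close>

definition bonacci_morphism_inf :: "nat \<Rightarrow> nat stream \<Rightarrow> nat stream" where
  "bonacci_morphism_inf m w = flat (smap (bonacci_letter m) w)"

definition bonacci_h :: "nat \<Rightarrow> nat \<Rightarrow> nat list" where
  "bonacci_h m n = (bonacci_morphism m ^^ n) [0]"

definition bonacci_word :: "nat \<Rightarrow> nat stream" where
  "bonacci_word m =
     (THE w. sset w \<subseteq> {0..<m} \<and> shd w = 0 \<and> bonacci_morphism_inf m w = w)"

text \<open>
  The words \<open>z\<^sub>n\<close>. All quotients occurring here are well defined, since \<open>h\<^sub>n\<close> ends with the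
  letter \<open>n mod m\<close> (lemma \<open>rev_bonacci_h\<close> below).
\<close>

definition bonacci_z :: "nat \<Rightarrow> nat \<Rightarrow> nat list" where
  "bonacci_z m n =
    (let hR = (\<lambda>i. rev (bonacci_h m i)) in
     if n = 0 then [0]
     else if n = 1 then [1]
     else if n = 2 then (if m \<ge> 3 then [0, 2, 0] else [0, 0])
     else if m = 2 then
       left_quotient [(n - 3) mod m] (hR (n - 3)) @ hR (n - 2) @ [(n - 2) mod m]
     else if n \<le> m - 1 then
       left_quotient [n - 3] (hR (n - 3)) @ hR (n - 2) @ [n] @
       concat (map hR [0..<n - 2]) @ [n - 2]
     else
       left_quotient [(n - 3) mod m] (hR (n - 3)) @ hR (n - 2) @
       concat (map hR [n - m..<n - 2]) @ [(n - 2) mod m])"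

lemma bonacci_letter_ne [simp]: "bonacci_letter m i \<noteq> []"
  by (simp add: bonacci_letter_def)

lemma bonacci_morphism_simps [simp]:
  "bonacci_morphism m [] = []"
  "bonacci_morphism m (a # w) = bonacci_letter m a @ bonacci_morphism m w"
  "bonacci_morphism m (u @ v) = bonacci_morphism m u @ bonacci_morphism m v"
  by (simp_all add: bonacci_morphism_def)

lemma bonacci_h_simps [simp]:
  "bonacci_h m 0 = [0]"
  "bonacci_h m (Suc n) = bonacci_morphism m (bonacci_h m n)"
  by (simp_all add: bonacci_h_def)

lemma bonacci_morphism_inf_shift:
  "bonacci_morphism_inf m (u @- s) = bonacci_morphism m u @- bonacci_morphism_inf m s"
  by (induction u) (simp_all add: bonacci_morphism_inf_def)

lemma rev_bonacci_h:
  assumes "m \<ge> 2"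
  shows "\<exists>v. rev (bonacci_h m n) = [n mod m] @ v"
proof -
  have "\<exists>v. bonacci_h m n = v @ [n mod m]"
  proof (induction n)
    case (Suc n)
    then obtain v where v: "bonacci_h m n = v @ [n mod m]" by blast
    show ?case
    proof (cases "n mod m + 1 < m")
      case True
      then have "Suc n mod m = n mod m + 1" by (simp add: mod_Suc)
      then show ?thesis using v True by (simp add: bonacci_letter_def)
    next
      case False
      moreover have "n mod m < m" using assms by simp
      ultimately have "Suc n mod m = 0" by (simp add: mod_Suc)
      then show ?thesis using v False by (simp add: bonacci_letter_def)
    qed
  qed simp
  then show ?thesis by force
qed

lemma bonacci_h_step:
  assumes "m \<ge> 2"
  shows "\<exists>v. v \<noteq> [] \<and> bonacci_h m (Suc n) = bonacci_h m n @ v"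
proof (induction n)
  case 0
  show ?case using assms by (auto simp: bonacci_letter_def)
next
  case (Suc n)
  then obtain v where v: "v \<noteq> []" "bonacci_h m (Suc n) = bonacci_h m n @ v" by blast
  have "bonacci_h m (Suc (Suc n)) = bonacci_h m (Suc n) @ bonacci_morphism m v"
    by (metis bonacci_h_simps(2) bonacci_morphism_simps(3) v(2))
  moreover have "bonacci_morphism m v \<noteq> []" using v(1) by (cases v) auto
  ultimately show ?case by blast
qed

lemma length_bonacci_h: "m \<ge> 2 \<Longrightarrow> n < length (bonacci_h m n)"
proof (induction n)
  case (Suc n)
  obtain v where "v \<noteq> []" "bonacci_h m (Suc n) = bonacci_h m n @ v"
    using bonacci_h_step[OF Suc.prems] by blast
  then have "length (bonacci_h m n) < length (bonacci_h m (Suc n))" by simp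
  then show ?case using Suc by linarith
qed simp

lemma prefix_bonacci_h:
  assumes "m \<ge> 2" "i \<le> j"
  shows "prefix (bonacci_h m i) (bonacci_h m j)"
  using assms(2)
proof (induction rule: dec_induct)
  case (step n)
  then show ?case
    using bonacci_h_step[OF assms(1), of n] by (metis prefix_def prefix_order.trans)
qed simp

lemma set_bonacci_h: "m \<ge> 2 \<Longrightarrow> set (bonacci_h m n) \<subseteq> {0..<m}"
proof (induction n)
  case (Suc n)
  then show ?case by (auto simp: bonacci_morphism_def bonacci_letter_def)
qed simp

lemma fixed_point_bonacci_h:
  assumes "shd w = 0" "bonacci_morphism_inf m w = w"
  shows "\<exists>t. w = bonacci_h m n @- t"
proof (induction n)
  case 0
  show ?case using assms(1) by (metis bonacci_h_simps(1) shift.simps stream.collapse)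
next
  case (Suc n)
  then show ?case by (metis assms(2) bonacci_h_simps(2) bonacci_morphism_inf_shift)
qed

lemma stream_eq_snth:
  assumes "\<And>n. s !! n = t !! n"
  shows "s = t"
proof -
  have "(!!) s = (!!) t" using assms by blast
  then have "smap ((!!) s) nats = smap ((!!) t) nats" by (rule arg_cong)
  then show ?thesis by (simp only: stream_smap_nats[symmetric])
qed

lemma bonacci_word_ex1:
  assumes m: "m \<ge> 2"
  shows "\<exists>!w. sset w \<subseteq> {0..<m} \<and> shd w = 0 \<and> bonacci_morphism_inf m w = w"
proof (rule ex_ex1I)
  define w where "w = smap (\<lambda>n. bonacci_h m n ! n) nats"
  have nth: "w !! i = bonacci_h m n ! i" if "i < length (bonacci_h m n)" for i n
  proof -
    have "bonacci_h m i ! i = bonacci_h m n ! i"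
    proof (cases "i \<le> n")
      case True
      then show ?thesis
        using prefix_bonacci_h[OF m] length_bonacci_h[OF m, of i]
        by (metis nth_append prefix_def)
    next
      case False
      then show ?thesis
        using prefix_bonacci_h[OF m, of n i] that by (metis nat_le_linear nth_append prefix_def)
    qed
    then show ?thesis by (simp add: w_def)
  qed
  have pre: "w = bonacci_h m n @- sdrop (length (bonacci_h m n)) w" for n
  proof -
    have "stake (length (bonacci_h m n)) w = bonacci_h m n"
      by (rule nth_equalityI) (simp_all add: nth)
    then show ?thesis by (metis stake_sdrop)
  qed
  have "bonacci_morphism_inf m w !! n = w !! n" for n
  proof -
    have "bonacci_morphism_inf m w =
        bonacci_h m (Suc n) @- bonacci_morphism_inf m (sdrop (length (bonacci_h m n)) w)"
      by (subst pre[of n]) (simp add: bonacci_morphism_inf_shift)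
    moreover have "n < length (bonacci_h m (Suc n))"
      using length_bonacci_h[OF m, of "Suc n"] by linarith
    ultimately show ?thesis using nth[of n "Suc n"] by (metis shift_snth_less)
  qed
  then have "bonacci_morphism_inf m w = w"
    by (rule stream_eq_snth)
  moreover have "shd w = 0" by (simp add: w_def)
  moreover have "sset w \<subseteq> {0..<m}"
  proof
    fix a assume "a \<in> sset w"
    then obtain n where "a = bonacci_h m n ! n" by (auto simp: w_def stream.set_map)
    then have "a \<in> set (bonacci_h m n)" using length_bonacci_h[OF m, of n] by simp
    then show "a \<in> {0..<m}" using set_bonacci_h[OF m, of n] by blast
  qed
  ultimately show "\<exists>w. sset w \<subseteq> {0..<m} \<and> shd w = 0 \<and> bonacci_morphism_inf m w = w"
    by blast
next
  fix w w'
  assume "sset w \<subseteq> {0..<m} \<and> shd w = 0 \<and> bonacci_morphism_inf m w = w"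
    and "sset w' \<subseteq> {0..<m} \<and> shd w' = 0 \<and> bonacci_morphism_inf m w' = w'"
  then have w: "\<exists>t. w = bonacci_h m n @- t" and w': "\<exists>t. w' = bonacci_h m n @- t" for n
    by (simp_all only: fixed_point_bonacci_h)
  have "w !! n = w' !! n" for n
  proof -
    obtain t t' where "w = bonacci_h m n @- t" "w' = bonacci_h m n @- t'"
      using w w' by blast
    then show ?thesis using length_bonacci_h[OF m, of n] by (simp only: shift_snth_less)
  qed
  then show "w = w'" by (rule stream_eq_snth)
qed

end

theory Submission
  imports Defs
begin

text \<open>
  Let \<open>\<phi>\<close> be the morphism and \<open>\<psi>\<close> its mirror image, so that \<open>\<phi>(w) 0 = 0 \<psi>(w)\<close> and
  \<open>h\<^sub>n\<^sub>+\<^sub>1\<^sup>R = \<psi>(h\<^sub>n\<^sup>R)\<close>. The word \<open>z\<^sub>n\<close> begins and ends with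
  \<open>b\<^sub>n = (n-3)\<^sup>-\<^sup>1 h\<^sub>n\<^sub>-\<^sub>3\<^sup>R (n-2)\<close>. Passing from \<open>n\<close> to \<open>n + 1\<close> applies \<open>\<phi>\<close> to
  \<open>z\<^sub>n\<close>, \<open>b\<^sub>n\<close> and \<open>z\<^sub>0 \<cdots> z\<^sub>n\<close>, up to a zero at one end; since images of letters under \<open>\<phi>\<close>
  can be cut apart at the zeros, it follows by induction that \<open>b\<^sub>n\<close> occurs in \<open>z\<^sub>n\<close> only at
  the two ends and that \<open>z\<^sub>n\<close> occurs in \<open>z\<^sub>0 \<cdots> z\<^sub>n\<close> only at the end.

  For minimality let \<open>y = (n-3)\<^sup>-\<^sup>1 h\<^sub>n\<^sub>-\<^sub>3\<^sup>R h\<^sub>n\<^sub>-\<^sub>2\<^sup>R\<close>, a prefix of \<open>z\<^sub>n\<close>. It is a suffix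
  of \<open>h\<^sub>0\<^sup>R \<cdots> h\<^sub>n\<^sub>-\<^sub>2\<^sup>R\<close>, which is a prefix of \<open>z\<^sub>0 \<cdots> z\<^sub>n\<^sub>-\<^sub>1\<close>, so the prefixes of \<open>y\<close> have
  occurred before. A prefix of \<open>z\<^sub>n\<close> strictly between \<open>y\<close> and \<open>z\<^sub>n\<close> is not closed: a border at
  least as long as \<open>b\<^sub>n\<close> would give \<open>b\<^sub>n\<close> a forbidden occurrence, and a shorter one occurs a
  third time, because \<open>h\<^sub>n\<^sub>-\<^sub>3\<^sup>R\<close> is a suffix of \<open>h\<^sub>n\<^sub>-\<^sub>2\<^sup>R\<close>.
\<close>

section \<open>Occurrences\<close>

lemma finite_occurrences: "finite {(u, v). w = u @ x @ v}"
proof (rule finite_subset)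
  show "{(u, v). w = u @ x @ v} \<subseteq> set (prefixes w) \<times> set (suffixes w)"
    by (auto simp: suffix_def)
qed simp

lemma card_le_occurrences:
  assumes "A \<subseteq> {(u, v). w = u @ x @ v}"
  shows "card A \<le> occurrences x w"
  unfolding occurrences_def using assms finite_occurrences by (rule card_mono[rotated])

lemma occurrences_eq_1I:
  assumes "\<And>u v. w @ x = u @ x @ v \<Longrightarrow> v = []"
  shows "occurrences x (w @ x) = 1"
proof -
  have "{(u, v). w @ x = u @ x @ v} = {(w, [])}"
    using assms by fastforce
  then show ?thesis by (simp add: occurrences_def)
qed

lemma occurrences_self: "occurrences x x = 1"
proof -
  have "v = []" if "[] @ x = u @ x @ v" for u v
    using arg_cong[OF that, of length] by simp
  then show ?thesis using occurrences_eq_1I[of "[]" x] by simp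
qed

lemma occurrences_eq_2I:
  assumes "border x w" "x \<noteq> w"
    and "\<And>u v. w = u @ x @ v \<Longrightarrow> u = [] \<or> v = []"
  shows "occurrences x w = 2"
proof -
  obtain u v where u: "w = u @ x" and v: "w = x @ v"
    using assms(1) by (auto simp: border_def prefix_def suffix_def)
  have "{(u, v). w = u @ x @ v} = {(u, []), ([], v)}"
  proof (intro equalityI subsetI, goal_cases)
    case (1 a)
    obtain u' v' where a: "a = (u', v')" by fastforce
    with 1 have w: "w = u' @ x @ v'" by simp
    from assms(3)[OF w] show ?case using w u v a by auto
  qed (use u v in auto)
  moreover have "u \<noteq> []" using u assms(2) by auto
  ultimately show ?thesis by (simp add: occurrences_def)
qed

text \<open>Minimality thus only has to be tested on the proper prefixes of the next factor.\<close>

lemma stream_prefix_cases: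
  assumes "stream_prefix x (z @- s)" "length x < length z"
  obtains e where "z = x @ e" "e \<noteq> []"
proof -
  obtain t where t: "z @- s = x @- t" using assms(1) by (auto simp: stream_prefix_def)
  define n where "n = length x"
  have "stake n (z @- s) = take n z" using assms(2) by (simp add: n_def stake_shift)
  moreover have "stake n (x @- t) = x" by (simp add: n_def stake_shift)
  ultimately have "take n z = x" using t by simp
  then have "z = x @ drop n z" by (metis append_take_drop_id)
  moreover have "drop n z \<noteq> []" using assms(2) by (simp add: n_def)
  ultimately show ?thesis using that by blast
qed


section \<open>The morphism and its mirror image\<close>

definition mirror_morphism :: "nat \<Rightarrow> nat list \<Rightarrow> nat list" where
  "mirror_morphism m w = concat (map (\<lambda>i. rev (bonacci_letter m i)) w)"

definition rev_h :: "nat \<Rightarrow> nat \<Rightarrow> nat list" where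
  "rev_h m n = rev (bonacci_h m n)"

lemma mirror_morphism_simps [simp]:
  "mirror_morphism m [] = []"
  "mirror_morphism m (a # w) = rev (bonacci_letter m a) @ mirror_morphism m w"
  "mirror_morphism m (u @ v) = mirror_morphism m u @ mirror_morphism m v"
  by (simp_all add: mirror_morphism_def)

text \<open>It holds letter by letter: the image of \<open>i\<close> is \<open>[0]\<close> or
  \<open>[0, i + 1]\<close>, so moving a 0 from its right end to its left end leaves the reversed
  image.\<close>

lemma bonacci_morphism_conjugate: "bonacci_morphism m w @ [0] = 0 # mirror_morphism m w"
  by (induction w) (auto simp: bonacci_letter_def)

lemma rev_bonacci_morphism: "rev (bonacci_morphism m w) = mirror_morphism m (rev w)"
  by (induction w) auto

lemma rev_h_simps [simp]:
  "rev_h m 0 = [0]"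
  "rev_h m (Suc n) = mirror_morphism m (rev_h m n)"
  by (simp_all add: rev_h_def rev_bonacci_morphism)

lemma rev_h_Suc_diff: "i \<le> n \<Longrightarrow> rev_h m (Suc n - i) = mirror_morphism m (rev_h m (n - i))"
  by (simp add: Suc_diff_le)

lemma mirror_morphism_concat_rev_h:
  "mirror_morphism m (concat (map (rev_h m) [i..<j])) = concat (map (rev_h m) [Suc i..<Suc j])"
  by (induction j) auto

lemma rev_h_Cons:
  assumes "m \<ge> 2"
  shows "rev_h m n = n mod m # tl (rev_h m n)"
  using rev_bonacci_h[OF assms, of n] by (auto simp: rev_h_def)

lemma suffix_rev_h: "m \<ge> 2 \<Longrightarrow> i \<le> j \<Longrightarrow> suffix (rev_h m i) (rev_h m j)"
  using prefix_bonacci_h[of m i j] by (simp add: rev_h_def suffix_to_prefix)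

lemma set_rev_h: "m \<ge> 2 \<Longrightarrow> set (rev_h m n) \<subseteq> {..<m}"
  using set_bonacci_h[of m n] by (auto simp: rev_h_def)

section \<open>Cutting images apart at the zeros\<close>

lemma bonacci_morphism_hd: "\<exists>w'. bonacci_morphism m w @ [0] = 0 # w'"
  by (auto simp: bonacci_morphism_conjugate)

text \<open>A nonzero letter can only end the image of a letter, and the next image, or the final
  \<open>[0]\<close>, begins with 0.\<close>

lemma bonacci_morphism_no_adjacent_nonzero:
  assumes "bonacci_morphism m w @ [0] = u @ [a, b] @ v" "a \<noteq> 0"
  shows "b = 0"
  using assms
proof (induction w arbitrary: u)
  case (Cons c w)
  obtain w' where w': "bonacci_morphism m w @ [0] = 0 # w'"
    using bonacci_morphism_hd by blast
  show ?case
  proof (cases u)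
    case Nil
    then show ?thesis
      using Cons.prems w' by (auto simp: bonacci_letter_def split: if_splits)
  next
    case u: (Cons d u')
    show ?thesis
    proof (cases u')
      case Nil
      then show ?thesis
        using Cons.prems w' u Cons.IH[of "[]"] by (auto simp: bonacci_letter_def split: if_splits)
    next
      case (Cons e u'')
      then show ?thesis
        using Cons.prems u Cons.IH[of u'] Cons.IH[of u'']
        by (auto simp: bonacci_letter_def split: if_splits)
    qed
  qed
qed (auto simp: Cons_eq_append_conv)

lemma bonacci_morphism_prefix_decode:
  assumes "bonacci_morphism m W @ [0] = bonacci_morphism m w @ 0 # v"
    and "set W \<subseteq> {..<m}" "set w \<subseteq> {..<m}"
  shows "\<exists>B. W = w @ B \<and> bonacci_morphism m B @ [0] = 0 # v"
  using assms
proof (induction w arbitrary: W)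
  case (Cons c w)
  show ?case
  proof (cases W)
    case Nil
    then show ?thesis using Cons.prems by (auto simp: bonacci_letter_def split: if_splits)
  next
    case W: (Cons d W')
    obtain x where x: "bonacci_morphism m W' @ [0] = 0 # x"
      using bonacci_morphism_hd by blast
    obtain y where y: "bonacci_morphism m w @ 0 # v = 0 # y"
      using bonacci_morphism_hd[of m w] by (cases "bonacci_morphism m w") auto
    have cd: "c < m" "d < m" using Cons.prems W by auto
    have eq: "bonacci_letter m d @ 0 # x = bonacci_letter m c @ 0 # y"
      using Cons.prems(1) x y W by simp
    \<comment> \<open>The second letter decides: it is 0 after the image of \<open>m - 1\<close> and
      \<open>i + 1\<close> for any other letter \<open>i < m\<close>.\<close>
    then have "d = c" using cd by (auto simp: bonacci_letter_def split: if_splits)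
    with eq x y have "bonacci_morphism m W' @ [0] = bonacci_morphism m w @ 0 # v" by simp
    with Cons.IH[of W'] Cons.prems W \<open>d = c\<close> show ?thesis by auto
  qed
qed simp

text \<open>A zero marks the beginning of an image of a letter, so the cutting points are determined.\<close>

lemma bonacci_morphism_decode:
  assumes "bonacci_morphism m W @ [0] = u @ bonacci_morphism m w @ 0 # v"
    and "set W \<subseteq> {..<m}" "set w \<subseteq> {..<m}"
  shows "\<exists>A B. W = A @ w @ B \<and> bonacci_morphism m A = u \<and> bonacci_morphism m B @ [0] = 0 # v"
  using assms
proof (induction W arbitrary: u)
  case Nil
  then have "u = []" "bonacci_morphism m w = []" "v = []"
    by (auto simp: Cons_eq_append_conv append_eq_Cons_conv)
  moreover from this have "w = []" by (cases w) auto
  ultimately show ?case by auto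
next
  case (Cons d W)
  obtain y where y: "bonacci_morphism m w @ 0 # v = 0 # y"
    using bonacci_morphism_hd[of m w] by (cases "bonacci_morphism m w") auto
  have IH: "\<exists>A B. d # W = A @ w @ B \<and> bonacci_morphism m A = bonacci_letter m d @ u' \<and>
      bonacci_morphism m B @ [0] = 0 # v"
    if "bonacci_morphism m W @ [0] = u' @ bonacci_morphism m w @ 0 # v" for u'
  proof -
    from Cons.IH[OF that] Cons.prems obtain A B where
      "W = A @ w @ B" "bonacci_morphism m A = u'" "bonacci_morphism m B @ [0] = 0 # v" by auto
    then show ?thesis by (intro exI[of _ "d # A"] exI[of _ B]) simp
  qed
  show ?case
  proof (cases "u = []")
    case True
    then show ?thesis using bonacci_morphism_prefix_decode[of m "d # W" w v] Cons.prems
      by (metis append_Nil bonacci_morphism_simps(1))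
  next
    case False
    show ?thesis
    proof (cases "d + 1 < m")
      case True
      then have "0 # (d + 1) # bonacci_morphism m W @ [0] = u @ 0 # y"
        using Cons.prems(1) y by (simp add: bonacci_letter_def)
      \<comment> \<open>\<open>u\<close> cannot stop inside the image of \<open>d\<close>, since
        \<open>d + 1\<close> is not the 0 that begins the remainder.\<close>
      with False obtain u' where u: "u = 0 # (d + 1) # u'"
        by (auto simp: Cons_eq_append_conv)
      with Cons.prems(1) True IH[of u'] show ?thesis by (auto simp: bonacci_letter_def)
    next
      case d: False
      then obtain u' where u: "u = 0 # u'"
        using False Cons.prems(1) by (cases u) (auto simp: bonacci_letter_def)
      with Cons.prems(1) d IH[of u'] show ?thesis by (auto simp: bonacci_letter_def)
    qed
  qed
qed


section \<open>The structure of the factors\<close>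

text \<open>
  In \<open>h\<^sub>\<omega>\<close>, the prefix \<open>hprod m n\<close> is followed by \<open>h\<^sub>n\<^sup>R\<close>, and \<open>head_block m n\<close> is what
  precedes \<open>h\<^sub>n\<^sub>-\<^sub>2\<^sup>R h\<^sub>n\<^sub>-\<^sub>1\<^sup>R\<close> in \<open>h\<^sub>n\<^sup>R\<close>. The word \<open>z\<^sub>n\<close> is \<open>z_core m n\<close> with its first letter
  moved to the left factor and the first letter of the next core appended.
\<close>

definition hprod :: "nat \<Rightarrow> nat \<Rightarrow> nat list" where
  "hprod m n = concat (map (rev_h m) [0..<n])"

definition head_block :: "nat \<Rightarrow> nat \<Rightarrow> nat list" where
  "head_block m n = (if n < m then n # hprod m (n - 2)
     else concat (map (rev_h m) [n - m..<n - 2]))"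

definition z_core :: "nat \<Rightarrow> nat \<Rightarrow> nat list" where
  "z_core m n = rev_h m (n - 3) @ rev_h m (n - 2) @ head_block m n"

lemma hprod_Suc [simp]: "hprod m (Suc n) = hprod m n @ rev_h m n"
  by (simp add: hprod_def)

lemma hprod_Suc_mirror: "hprod m (Suc n) = 0 # mirror_morphism m (hprod m n)"
  unfolding hprod_def mirror_morphism_concat_rev_h by (subst upt_conv_Cons) auto

text \<open>The letter \<open>n\<close> carries the change of form: its mirror image is
  \<open>[n + 1, 0]\<close> if \<open>n + 1 < m\<close> and \<open>[0]\<close> if
  \<open>n + 1 = m\<close>. Both times the 0 becomes \<open>rev_h m 0\<close>, the first factor of
  the next product.\<close>

lemma head_block_Suc:
  assumes m: "m \<ge> 2" and n: "n \<ge> 2"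
  shows "head_block m (Suc n) = mirror_morphism m (head_block m n)"
proof -
  obtain k where k: "n = Suc (Suc k)" using n by (metis Suc_le_D numeral_2_eq_2 Suc_le_mono)
  consider "Suc n < m" | "Suc n = m" | "n \<ge> m" by linarith
  then show ?thesis
  proof cases
    case 1
    then show ?thesis
      by (simp add: head_block_def bonacci_letter_def k hprod_Suc_mirror del: hprod_Suc)
  next
    case 2
    have "hprod m (Suc k) = 0 # mirror_morphism m (hprod m k)" by (rule hprod_Suc_mirror)
    moreover have "head_block m (Suc n) = hprod m (Suc k)"
      using 2 k by (auto simp: head_block_def hprod_def)
    moreover have "head_block m n = n # hprod m k" "\<not> n + 1 < m"
      using 2 k by (auto simp: head_block_def)
    ultimately show ?thesis by (simp add: bonacci_letter_def)
  next
    case 3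
    then show ?thesis
      using m by (simp add: head_block_def mirror_morphism_concat_rev_h Suc_diff_le k)
  qed
qed

lemma head_block_2: "m \<ge> 2 \<Longrightarrow> head_block m 2 = (if m = 2 then [] else [2])"
  by (auto simp: head_block_def hprod_def)

lemma rev_h_1: "m \<ge> 2 \<Longrightarrow> rev_h m (Suc 0) = [1, 0]"
  by (simp add: bonacci_letter_def)

text \<open>This is the reversed m-bonacci recurrence, with everything before the last two blocks
  collected in \<open>head_block\<close>.\<close>

lemma rev_h_decomp:
  assumes m: "m \<ge> 2" and n: "n \<ge> 2"
  shows "rev_h m n = head_block m n @ rev_h m (n - 2) @ rev_h m (n - 1)"
  using n
proof (induction n rule: dec_induct)
  case base
  show ?case using m head_block_2[OF m]
    by (auto simp: numeral_2_eq_2 bonacci_letter_def)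
next
  case (step n)
  have "rev_h m (Suc n - 2) = mirror_morphism m (rev_h m (n - 2))"
      "rev_h m (Suc n - 1) = mirror_morphism m (rev_h m (n - 1))"
    using step.hyps(1) by (auto intro!: rev_h_Suc_diff simp only:)
  moreover have "rev_h m (Suc n) = mirror_morphism m (head_block m n) @
      mirror_morphism m (rev_h m (n - 2)) @ mirror_morphism m (rev_h m (n - 1))"
    using step.IH by (metis mirror_morphism_simps(3) rev_h_simps(2))
  ultimately show ?case using head_block_Suc[OF m step.hyps(1)] by metis
qed

lemma z_core_Suc:
  assumes "m \<ge> 2" "n \<ge> 3"
  shows "z_core m (Suc n) = mirror_morphism m (z_core m n)"
  using assms rev_h_Suc_diff[of 2 n m] rev_h_Suc_diff[of 3 n m]
  by (simp add: z_core_def head_block_Suc)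

lemma set_hprod: "m \<ge> 2 \<Longrightarrow> set (hprod m n) \<subseteq> {..<m}"
  using set_rev_h[of m] by (auto simp: hprod_def)

lemma set_head_block: "m \<ge> 2 \<Longrightarrow> set (head_block m n) \<subseteq> {..<m}"
  using set_rev_h[of m] set_hprod[of m "n - 2"] by (auto simp: head_block_def)

lemma set_z_core: "m \<ge> 2 \<Longrightarrow> set (z_core m n) \<subseteq> {..<m}"
  using set_rev_h[of m] set_head_block[of m n] by (auto simp: z_core_def)

lemma z_core_Cons:
  "m \<ge> 2 \<Longrightarrow> z_core m n = (n - 3) mod m # tl (rev_h m (n - 3)) @ rev_h m (n - 2) @ head_block m n"
  unfolding z_core_def by (subst rev_h_Cons) auto

text \<open>\<open>head_block\<close> unifies the cases in the definition of
  \<open>bonacci_z\<close>; for \<open>m = 2\<close> its index range is empty.\<close>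

lemma bonacci_z_core:
  assumes m: "m \<ge> 2" and n: "n \<ge> 3"
  shows "bonacci_z m n = tl (z_core m n) @ [(n - 2) mod m]"
proof -
  have lq: "left_quotient [(n - 3) mod m] (rev (bonacci_h m (n - 3))) = tl (rev_h m (n - 3))"
    using rev_h_Cons[OF m, of "n - 3"]
    by (metis append_Cons append_Nil left_quotient_append rev_h_def)
  have fold: "(\<lambda>i. rev (bonacci_h m i)) = rev_h m" by (auto simp: rev_h_def)
  have z: "tl (z_core m n) = tl (rev_h m (n - 3)) @ rev_h m (n - 2) @ head_block m n"
    using z_core_Cons[OF m, of n] by simp
  consider "m = 2" | "m \<ge> 3" "n < m" | "m \<ge> 3" "n \<ge> m" using m by linarith
  then show ?thesis
  proof cases
    case 1
    then show ?thesis using n lq z unfolding bonacci_z_def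
      by (simp add: head_block_def rev_h_def Let_def)
  next
    case 2
    then show ?thesis using n lq z unfolding bonacci_z_def Let_def fold
      by (simp add: head_block_def rev_h_def[of m "n - 3", symmetric] hprod_def)
  next
    case 3
    then show ?thesis using n lq z unfolding bonacci_z_def Let_def fold
      by (simp add: head_block_def rev_h_def[of m "n - 3", symmetric])
  qed
qed

section \<open>The product of the factors is the infinite word\<close>

text \<open>For \<open>n \<ge> 2\<close> this is the product of \<open>z\<^sub>0\<close>, ...,
  \<open>z\<^sub>n\<close> without its last letter.\<close>

definition z_prefix :: "nat \<Rightarrow> nat \<Rightarrow> nat list" where
  "z_prefix m n = hprod m n @ head_block m n"

lemma z_prefix_Suc:
  assumes "m \<ge> 2" "n \<ge> 2"
  shows "z_prefix m (Suc n) = bonacci_morphism m (z_prefix m n) @ [0]"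
  using assms
  by (simp add: z_prefix_def hprod_Suc_mirror head_block_Suc bonacci_morphism_conjugate del: hprod_Suc)

text \<open>\<open>head_block m n\<close> starts \<open>rev_h m n\<close>, and the two remaining
  blocks of \<open>rev_h m n\<close> start the next core.\<close>

lemma z_prefix_Suc_core:
  assumes m: "m \<ge> 2" and n: "n \<ge> 2"
  shows "z_prefix m (Suc n) = z_prefix m n @ z_core m (Suc n)"
  using rev_h_decomp[OF assms] n by (simp add: z_prefix_def z_core_def)

lemma z_prefix_2: "m \<ge> 2 \<Longrightarrow> z_prefix m 2 = (if m = 2 then [0, 1, 0] else [0, 1, 0, 2])"
  using head_block_2[of m]
  by (auto simp: z_prefix_def hprod_def numeral_2_eq_2 bonacci_letter_def)

lemma set_z_prefix: "m \<ge> 2 \<Longrightarrow> set (z_prefix m n) \<subseteq> {..<m}"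
  using set_hprod[of m n] set_head_block[of m n] by (auto simp: z_prefix_def)

lemma concat_bonacci_z:
  assumes m: "m \<ge> 2" and n: "n \<ge> 2"
  shows "concat (map (bonacci_z m) [0..<Suc n]) = z_prefix m n @ [(n - 2) mod m]"
  using n
proof (induction n rule: dec_induct)
  case base
  have "[0..<Suc 2] = [0, 1, 2]" by (simp add: upt_rec)
  then show ?case using m by (auto simp: z_prefix_2[OF m] bonacci_z_def)
next
  case (step n)
  \<comment> \<open>The last letter of the product so far is the first letter of the next core,
    which \<open>bonacci_z\<close> drops.\<close>
  have "z_core m (Suc n) = (n - 2) mod m # tl (z_core m (Suc n))"
    using z_core_Cons[OF m, of "Suc n"] by simp
  then have "[(n - 2) mod m] @ tl (z_core m (Suc n)) = z_core m (Suc n)" by simp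
  then have "z_prefix m (Suc n) @ [(Suc n - 2) mod m] =
      (z_prefix m n @ [(n - 2) mod m]) @ tl (z_core m (Suc n)) @ [(Suc n - 2) mod m]"
    using z_prefix_Suc_core[OF m step.hyps(1)] by (metis append.assoc)
  also have "\<dots> = concat (map (bonacci_z m) [0..<Suc n]) @ bonacci_z m (Suc n)"
    using step bonacci_z_core[OF m, of "Suc n"] by simp
  finally show ?case by simp
qed

lemma bonacci_z_nonempty: "m \<ge> 2 \<Longrightarrow> bonacci_z m n \<noteq> []"
proof (cases "n \<ge> 3")
  case False
  then have "n = 0 \<or> n = 1 \<or> n = 2" by auto
  then show ?thesis by (auto simp: bonacci_z_def)
qed (simp add: bonacci_z_core)

lemma bonacci_word_fixed:
  assumes "m \<ge> 2"
  shows "shd (bonacci_word m) = 0" "bonacci_morphism_inf m (bonacci_word m) = bonacci_word m"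
  using theI'[OF bonacci_word_ex1[OF assms]] unfolding bonacci_word_def by blast+

lemma bonacci_morphism_inf_hd: "shd (bonacci_morphism_inf m s) = 0"
  unfolding bonacci_morphism_inf_def
  by (subst stream.collapse[of s, symmetric], subst stream.map, subst flat_unfold)
     (auto simp: bonacci_letter_def)

lemma bonacci_word_z_prefix:
  assumes m: "m \<ge> 2" and n: "n \<ge> 2"
  shows "\<exists>t. bonacci_word m = z_prefix m n @- t"
  using n
proof (induction n rule: dec_induct)
  case base
  obtain t where t: "bonacci_word m = bonacci_h m 2 @- t"
    using fixed_point_bonacci_h[OF bonacci_word_fixed[OF m]] by blast
  have "bonacci_h m 2 = z_prefix m 2"
    unfolding z_prefix_2[OF m] using m by (auto simp: numeral_2_eq_2 bonacci_letter_def)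
  then show ?case using t by metis
next
  case (step n)
  then obtain t where t: "bonacci_word m = z_prefix m n @- t" by blast
  have "bonacci_word m = bonacci_morphism m (z_prefix m n) @- bonacci_morphism_inf m t"
    using t bonacci_word_fixed(2)[OF m] by (metis bonacci_morphism_inf_shift)
  \<comment> \<open>The final 0 of \<open>z_prefix m (Suc n)\<close> comes from the tail, whose
    image begins with 0.\<close>
  also have "\<dots> = z_prefix m (Suc n) @- stl (bonacci_morphism_inf m t)"
    using bonacci_morphism_inf_hd[of m t] z_prefix_Suc[OF m] step
    by (metis shift.simps shift_append stream.collapse)
  finally show ?case by blast
qed

lemma length_concat_nonempty:
  assumes "\<And>i. y i \<noteq> []"
  shows "n \<le> length (concat (map y [0..<n]))"
proof (induction n)
  case (Suc n)
  then show ?case using assms[of n] by (cases "y n") auto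
qed simp

lemma bonacci_word_product:
  assumes m: "m \<ge> 2"
  shows "bonacci_word m = product_from 0 (bonacci_z m)"
proof (rule stream_eq_snth)
  fix n
  define c where "c = concat (map (bonacci_z m) [0..<n + 2])"
  define d where "d = concat (map (bonacci_z m) [0..<Suc (n + 2)])"
  have "n + 2 \<le> length c" unfolding c_def
    by (rule length_concat_nonempty) (rule bonacci_z_nonempty[OF m])
  have d: "d = c @ bonacci_z m (n + 2)" by (simp add: c_def d_def)
  have d': "d = z_prefix m (n + 2) @ [n mod m]"
    using concat_bonacci_z[OF m, of "n + 2"] by (simp add: d_def)
  have len: "length (z_prefix m (n + 2)) > n"
    using \<open>n + 2 \<le> length c\<close> arg_cong[OF d, of length] arg_cong[OF d', of length] by simp
  obtain t where "bonacci_word m = z_prefix m (n + 2) @- t"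
    using bonacci_word_z_prefix[OF m, of "n + 2"] by auto
  moreover have "product_from 0 (bonacci_z m) =
      z_prefix m (n + 2) @- ([n mod m] @- product_from (Suc (n + 2)) (bonacci_z m))"
    using product_from_0[of "bonacci_z m" "Suc (n + 2)", OF bonacci_z_nonempty[OF m]] d'
    unfolding d_def by (metis shift_append)
  ultimately show "bonacci_word m !! n = product_from 0 (bonacci_z m) !! n"
    using len by (metis shift_snth_less)
qed


section \<open>Occurrences of the factors and of their borders\<close>

text \<open>
  Both \<open>z\<^sub>k\<^sub>+\<^sub>3\<close> and its border arise from a word \<open>g\<close> (\<open>z_core m (k + 3)\<close> and \<open>h\<^sub>k\<^sup>R\<close>) by
  dropping its first letter and appending a letter; this operation commutes with the morphism
  up to a zero at one of the two ends.
\<close>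

definition slide :: "nat \<Rightarrow> nat \<Rightarrow> nat list \<Rightarrow> nat list" where
  "slide m k g = tl g @ [Suc k mod m]"

lemma set_slide: "m \<ge> 2 \<Longrightarrow> set g \<subseteq> {..<m} \<Longrightarrow> set (slide m k g) \<subseteq> {..<m}"
  by (cases g) (auto simp: slide_def)

text \<open>A 0 is missing on the left when the dropped letter is \<open>m - 1\<close>, whose mirror
  image is just \<open>[0]\<close>. On the right the 0 is already there when the new last letter is
  0.\<close>

lemma slide_image:
  assumes m: "m \<ge> 2" and g: "g = k mod m # g'"
  shows "(if Suc k mod m = 0 then [0] else []) @ slide m (Suc k) (mirror_morphism m g) @
      (if Suc (Suc k) mod m = 0 then [] else [0]) = bonacci_morphism m (slide m k g) @ [0]"
proof -
  have conj: "bonacci_morphism m g' @ 0 # w = 0 # mirror_morphism m g' @ w" for w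
    using bonacci_morphism_conjugate[of m g'] by (metis append.assoc append_Cons append_Nil)
  have lt: "k mod m < m" using m by simp
  then consider "Suc (Suc (k mod m)) < m" | "Suc (Suc (k mod m)) = m" | "Suc (k mod m) = m"
    by linarith
  then show ?thesis
    using m g by cases (auto simp: slide_def bonacci_letter_def mod_Suc conj)
qed

text \<open>An occurrence in \<open>W'\<close>, the image of \<open>W\<close> up to zeros at the
  ends, is pulled back to one in \<open>W\<close> that keeps a nonempty right context. The last
  equation controls the left context.\<close>

lemma slide_decode:
  assumes m: "m \<ge> 2" and g: "g = k mod m # g'"
    and second: "k mod m \<noteq> 0 \<Longrightarrow> \<exists>g''. g' = 0 # g''"
    and set: "set g \<subseteq> {..<m}" "set W \<subseteq> {..<m}"
    and W: "e @ W' @ (if Suc (Suc k) mod m = 0 then [] else [0]) = bonacci_morphism m W @ [0]"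
    and occ: "W' = u @ slide m (Suc k) (mirror_morphism m g) @ v" "v \<noteq> []"
  shows "\<exists>A B. W = A @ slide m k g @ B \<and> B \<noteq> [] \<and>
      bonacci_morphism m A @ (if Suc k mod m = 0 then [0] else []) = e @ u"
proof -
  define X where "X = slide m k g"
  define X' where "X' = slide m (Suc k) (mirror_morphism m g)"
  define f :: "nat list" where "f = (if Suc (Suc k) mod m = 0 then [] else [0])"
  define d :: "nat list" where "d = (if Suc k mod m = 0 then [0] else [])"
  have img: "d @ X' @ f = bonacci_morphism m X @ [0]"
    unfolding X_def X'_def d_def f_def by (rule slide_image[OF m g])
  have W': "bonacci_morphism m W @ [0] = (e @ u) @ X' @ v @ f"
    using W occ(1) by (simp add: f_def X'_def)
  have "\<exists>y. y \<noteq> [] \<and> d @ X' @ v @ f = bonacci_morphism m X @ 0 # y"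
  proof (cases "Suc (Suc k) mod m = 0")
    case True
    then have "f = []" by (simp add: f_def)
    then show ?thesis using img occ(2) by (intro exI[of _ v]) (metis append.assoc append_Cons append_Nil append_Nil2)
  next
    case False
    then have f: "f = [0]" by (simp add: f_def)
    obtain b v' where v: "v = b # v'" using occ(2) by (cases v) auto
    have "bonacci_morphism m W @ [0] =
        (e @ u @ tl (mirror_morphism m g)) @ [Suc (Suc k) mod m, b] @ (v' @ f)"
      using W' v by (simp add: X'_def slide_def)
    \<comment> \<open>\<open>X'\<close> ends in a nonzero letter, so the 0 that completes the image
      is the next letter of \<open>W'\<close>.\<close>
    then have "b = 0" using False bonacci_morphism_no_adjacent_nonzero by blast
    then show ?thesis using img f v
      by (intro exI[of _ "v' @ [0]"]) (metis append.assoc append_Cons append_Nil append_is_Nil_conv list.distinct(1))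
  qed
  then obtain y where y: "y \<noteq> []" "d @ X' @ v @ f = bonacci_morphism m X @ 0 # y" by blast
  \<comment> \<open>If \<open>d = [0]\<close>, then \<open>X'\<close> begins with 1, because the
    second letter of \<open>g\<close> is 0; hence a 0 stands before it.\<close>
  have "\<exists>u'. e @ u = u' @ d"
  proof (cases "Suc k mod m = 0")
    case True
    then have k: "k mod m = m - 1" using m by (auto simp: mod_Suc split: if_splits)
    with second m obtain g'' where g'': "g' = 0 # g''" by auto
    obtain x where x: "X' = 1 # x"
      using m g g'' k by (simp add: X'_def slide_def bonacci_letter_def)
    obtain w' where w': "bonacci_morphism m W @ [0] = 0 # w'"
      using bonacci_morphism_hd by blast
    have "e @ u \<noteq> []"
    proof
      assume "e @ u = []"
      with W' x w' show False by simp
    qed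
    then obtain u' a where u': "e @ u = u' @ [a]" by (metis rev_exhaust)
    have "bonacci_morphism m W @ [0] = u' @ [a, 1] @ (x @ v @ f)"
      using W' x u' by simp
    then have "a = 0" using bonacci_morphism_no_adjacent_nonzero by (metis zero_neq_one)
    with u' True show ?thesis by (simp add: d_def)
  qed (simp add: d_def)
  then obtain u' where u': "e @ u = u' @ d" by blast
  have "bonacci_morphism m W @ [0] = u' @ bonacci_morphism m X @ 0 # y"
    using W' u' y by simp
  moreover have "set X \<subseteq> {..<m}"
    unfolding X_def by (rule set_slide[OF m set(1)])
  ultimately obtain A B where "W = A @ X @ B" "bonacci_morphism m A = u'"
      "bonacci_morphism m B @ [0] = 0 # y"
    using bonacci_morphism_decode set(2) by meson
  moreover from this y(1) have "B \<noteq> []" by auto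
  ultimately show ?thesis using u' unfolding X_def d_def by auto
qed

text \<open>The head \<open>n mod m\<close> was created as part of the mirror image
  \<open>[n mod m, 0]\<close>.\<close>

lemma rev_h_second:
  assumes m: "m \<ge> 2" and n: "n mod m \<noteq> 0"
  shows "\<exists>g. tl (rev_h m n) = 0 # g"
proof -
  obtain k where k: "n = Suc k" using n by (cases n) auto
  moreover have "k mod m < m" using m by simp
  ultimately have "Suc (k mod m) < m" using n by (simp add: mod_Suc split: if_splits)
  then show ?thesis using rev_h_Cons[OF m, of k] k
    by (metis (no_types, lifting) Suc_eq_plus1 append_Cons bonacci_letter_def list.sel(3)
        mirror_morphism_simps(2) rev_h_simps(2) rev.simps append_Nil)
qed

text \<open>This is \<open>b\<^sub>n\<close> for \<open>n = k + 3\<close>; the shift avoids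
  truncated subtraction.\<close>

definition z_border :: "nat \<Rightarrow> nat \<Rightarrow> nat list" where
  "z_border m k = slide m k (rev_h m k)"

lemma bonacci_z_slide:
  "m \<ge> 2 \<Longrightarrow> bonacci_z m (k + 3) = slide m k (z_core m (k + 3))"
  using bonacci_z_core[of m "k + 3"] by (simp add: slide_def)

lemma bonacci_z_expand:
  assumes "m \<ge> 2"
  shows "bonacci_z m (k + 3) =
    tl (rev_h m k) @ rev_h m (Suc k) @ head_block m (k + 3) @ [Suc k mod m]"
  using bonacci_z_slide[OF assms] z_core_Cons[OF assms, of "k + 3"]
  by (simp add: slide_def numeral_2_eq_2 numeral_3_eq_3 del: rev_h_simps)

lemma bonacci_z_3:
  assumes "m \<ge> 2"
  shows "bonacci_z m 3 = (if m = 2 then [1, 0, 1] else if m = 3 then [1, 0, 0, 1] else [1, 0, 3, 0, 1])"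
proof -
  have "bonacci_z m 3 = [1, 0] @ head_block m 3 @ [1 mod m]"
    using assms bonacci_z_expand[OF assms, of 0] rev_h_1[OF assms] by simp
  moreover have "head_block m 3 = (if m = 2 then [] else if m = 3 then [0] else [3, 0])"
    using head_block_Suc[OF assms, of 2] head_block_2[OF assms] assms
    by (auto simp: bonacci_letter_def numeral_3_eq_3 numeral_2_eq_2)
  ultimately show ?thesis using assms by simp
qed

lemma z_border_only_ends:
  assumes m: "m \<ge> 2"
  shows "bonacci_z m (k + 3) = u @ z_border m k @ v \<Longrightarrow> u = [] \<or> v = []"
proof (induction k arbitrary: u v)
  case 0
  \<comment> \<open>For \<open>k = 0\<close> the border is \<open>[1]\<close>, and
    \<open>bonacci_z m 3\<close> contains 1 only at its ends.\<close>
  then show ?case using m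
    by (auto simp: bonacci_z_3 z_border_def slide_def Cons_eq_append_conv append_eq_Cons_conv
        split: if_splits)
next
  case (Suc k)
  show ?case
  proof (rule ccontr)
    assume "\<not> (u = [] \<or> v = [])"
    then have uv: "u \<noteq> []" "v \<noteq> []" by auto
    have core: "z_core m (k + 3) = k mod m # tl (z_core m (k + 3))"
      using z_core_Cons[OF m, of "k + 3"] by simp
    have eq: "bonacci_z m (Suc k + 3) = slide m (Suc k) (mirror_morphism m (z_core m (k + 3)))"
      using bonacci_z_slide[OF m, of "Suc k"] z_core_Suc[OF m, of "k + 3"] by simp
    have "\<exists>A B. bonacci_z m (k + 3) = A @ slide m k (rev_h m k) @ B \<and> B \<noteq> [] \<and>
      bonacci_morphism m A @ (if Suc k mod m = 0 then [0] else []) =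
        (if Suc k mod m = 0 then [0] else []) @ u"
    proof (rule slide_decode[OF m rev_h_Cons[OF m] rev_h_second[OF m] set_rev_h[OF m]])
      show "(if Suc k mod m = 0 then [0] else []) @ bonacci_z m (Suc k + 3) @
          (if Suc (Suc k) mod m = 0 then [] else [0]) = bonacci_morphism m (bonacci_z m (k + 3)) @ [0]"
        using slide_image[OF m core] eq bonacci_z_slide[OF m, of k] by simp
      show "bonacci_z m (Suc k + 3) = u @ slide m (Suc k) (mirror_morphism m (rev_h m k)) @ v"
        using Suc.prems by (simp add: z_border_def)
      show "set (bonacci_z m (k + 3)) \<subseteq> {..<m}"
        unfolding bonacci_z_slide[OF m] by (rule set_slide[OF m set_z_core[OF m]])
    qed (use uv in auto)
    then obtain A B where "bonacci_z m (k + 3) = A @ z_border m k @ B" "B \<noteq> []"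
      "bonacci_morphism m A @ (if Suc k mod m = 0 then [0] else []) =
        (if Suc k mod m = 0 then [0] else []) @ u"
      unfolding z_border_def by blast
    moreover from this(3) uv(1) have "A \<noteq> []" by auto
    ultimately show False using Suc.IH by blast
  qed
qed

text \<open>The word searched is the product of \<open>z\<^sub>0\<close>, ...,
  \<open>z\<^sub>n\<close> for \<open>n = k + 3\<close>. Its image loses no zero on the left, so
  \<open>slide_decode\<close> applies with \<open>e\<close> empty.\<close>

lemma bonacci_z_only_last:
  assumes m: "m \<ge> 2"
  shows "z_prefix m (k + 3) @ [Suc k mod m] = u @ bonacci_z m (k + 3) @ v \<Longrightarrow> v = []"
proof (induction k arbitrary: u v)
  case 0
  have "z_prefix m 3 = z_prefix m 2 @ z_core m 3"
    using z_prefix_Suc_core[OF m, of 2] by (simp add: numeral_3_eq_3 numeral_2_eq_2)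
  moreover have "z_core m 3 = 0 # butlast (bonacci_z m 3)"
  proof -
    have "z_core m 3 = 0 # tl (z_core m 3)" using z_core_Cons[OF m, of 3] by simp
    then show ?thesis using bonacci_z_slide[OF m, of 0] by (simp add: slide_def)
  qed
  ultimately show ?case using 0 m
    by (auto simp: bonacci_z_3 z_prefix_2 Cons_eq_append_conv append_eq_Cons_conv split: if_splits)
next
  case (Suc k)
  show ?case
  proof (rule ccontr)
    assume v: "v \<noteq> []"
    have core: "z_core m (k + 3) = k mod m # tl (z_core m (k + 3))"
      using z_core_Cons[OF m, of "k + 3"] by simp
    have eq: "bonacci_z m (Suc k + 3) = slide m (Suc k) (mirror_morphism m (z_core m (k + 3)))"
      using bonacci_z_slide[OF m, of "Suc k"] z_core_Suc[OF m, of "k + 3"] by simp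
    have pre: "z_prefix m (Suc k + 3) = bonacci_morphism m (z_prefix m (k + 3)) @ [0]"
      using z_prefix_Suc[OF m, of "k + 3"] by simp
    have "\<exists>A B. z_prefix m (k + 3) @ [Suc k mod m] = A @ slide m k (z_core m (k + 3)) @ B \<and>
      B \<noteq> [] \<and> bonacci_morphism m A @ (if Suc k mod m = 0 then [0] else []) = [] @ u"
    proof (rule slide_decode[OF m core _ set_z_core[OF m]])
      show "\<exists>g''. tl (z_core m (k + 3)) = 0 # g''" if "k mod m \<noteq> 0"
        using rev_h_second[OF m that] z_core_Cons[OF m, of "k + 3"] by auto
      show "[] @ (z_prefix m (Suc k + 3) @ [Suc (Suc k) mod m]) @
          (if Suc (Suc k) mod m = 0 then [] else [0]) =
          bonacci_morphism m (z_prefix m (k + 3) @ [Suc k mod m]) @ [0]"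
      proof -
        have "k mod m < m" using m by simp
        then consider "Suc (Suc (k mod m)) < m" | "Suc (Suc (k mod m)) = m" | "Suc (k mod m) = m"
          by linarith
        then show ?thesis unfolding pre using m by cases (auto simp: bonacci_letter_def mod_Suc)
      qed
      show "z_prefix m (Suc k + 3) @ [Suc (Suc k) mod m] =
          u @ slide m (Suc k) (mirror_morphism m (z_core m (k + 3))) @ v"
        using Suc.prems eq by simp
      show "set (z_prefix m (k + 3) @ [Suc k mod m]) \<subseteq> {..<m}"
        using set_z_prefix[OF m] m by auto
    qed (use v in auto)
    then show False using Suc.IH bonacci_z_slide[OF m] by metis
  qed
qed

lemma occurrences_bonacci_z:
  assumes m: "m \<ge> 2"
  shows "occurrences (bonacci_z m (k + 3))
    (concat (map (bonacci_z m) [0..<k + 3]) @ bonacci_z m (k + 3)) = 1"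
proof (rule occurrences_eq_1I)
  fix u v assume "concat (map (bonacci_z m) [0..<k + 3]) @ bonacci_z m (k + 3) =
    u @ bonacci_z m (k + 3) @ v"
  moreover have "concat (map (bonacci_z m) [0..<k + 3]) @ bonacci_z m (k + 3) =
      z_prefix m (k + 3) @ [Suc k mod m]"
    using concat_bonacci_z[OF m, of "k + 3"] by (simp add: numeral_2_eq_2 numeral_3_eq_3)
  ultimately show "v = []" using bonacci_z_only_last[OF m] by metis
qed

section \<open>The factors are closed\<close>

lemma z_border_prefix:
  assumes m: "m \<ge> 2"
  obtains c where "bonacci_z m (k + 3) = z_border m k @ c" "c \<noteq> []"
proof -
  have "rev_h m (Suc k) = Suc k mod m # tl (rev_h m (Suc k))" by (rule rev_h_Cons[OF m])
  then have "bonacci_z m (k + 3) =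
      z_border m k @ (tl (rev_h m (Suc k)) @ head_block m (k + 3) @ [Suc k mod m])"
    unfolding bonacci_z_expand[OF m] z_border_def slide_def
    by (metis append.assoc append_Cons append_Nil)
  then show ?thesis using that by blast
qed

text \<open>The last factor of the block has index \<open>k\<close>; only \<open>m = 2\<close> makes
  the block empty.\<close>

lemma suffix_head_block:
  assumes m: "m \<ge> 2" and h: "head_block m (k + 3) \<noteq> []"
  shows "suffix (rev_h m k) (head_block m (k + 3))"
proof (cases "k + 3 < m")
  case True
  then show ?thesis by (simp add: head_block_def suffix_def)
next
  case False
  with h have "m \<ge> 3" by (cases "m = 2") (auto simp: head_block_def)
  then have "[k + 3 - m..<k + 3 - 2] = [k + 3 - m..<k] @ [k]"
    by (simp add: numeral_2_eq_2 numeral_3_eq_3)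
  with False show ?thesis by (simp add: head_block_def suffix_def)
qed

text \<open>The suffix occurrence uses the copy of \<open>rev_h m k\<close> that ends
  \<open>head_block m (k + 3)\<close> or, if that is empty, \<open>rev_h m (Suc k)\<close>.\<close>

lemma border_z_border:
  assumes m: "m \<ge> 2"
  shows "border (z_border m k) (bonacci_z m (k + 3))"
proof -
  have "suffix (rev_h m k) (rev_h m (Suc k) @ head_block m (k + 3))"
    using suffix_rev_h[OF m, of k "Suc k"] suffix_head_block[OF m, of k]
    by (cases "head_block m (k + 3) = []") (auto simp: suffix_append simp del: rev_h_simps)
  then obtain c where "rev_h m (Suc k) @ head_block m (k + 3) = c @ rev_h m k"
    by (auto simp: suffix_def)
  moreover have "rev_h m k = [k mod m] @ tl (rev_h m k)" using rev_h_Cons[OF m, of k] by simp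
  ultimately have "bonacci_z m (k + 3) = (tl (rev_h m k) @ c @ [k mod m]) @ z_border m k"
    unfolding bonacci_z_expand[OF m] z_border_def slide_def
    by (metis append.assoc)
  moreover have "prefix (z_border m k) (bonacci_z m (k + 3))"
    using z_border_prefix[OF m, of k] by (metis prefixI)
  ultimately show ?thesis by (auto simp: border_def z_border_def slide_def suffix_def)
qed

lemma closed_bonacci_z:
  assumes m: "m \<ge> 2"
  shows "closed_word (bonacci_z m (k + 3))"
proof -
  have "z_border m k \<noteq> bonacci_z m (k + 3)"
    using z_border_prefix[OF m, of k] by (metis append_self_conv)
  then have "occurrences (z_border m k) (bonacci_z m (k + 3)) = 2"
    using border_z_border[OF m] z_border_only_ends[OF m] by (intro occurrences_eq_2I) auto
  then show ?thesis
    unfolding closed_word_def using border_z_border[OF m] bonacci_z_nonempty[OF m] by blast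
qed

section \<open>Minimality of the factors\<close>

lemma repeated_prefix:
  assumes m: "m \<ge> 2" and y: "tl (rev_h m k) @ rev_h m (Suc k) = x @ e"
  shows "occurrences x (concat (map (bonacci_z m) [0..<k + 3]) @ x) \<noteq> 1"
proof -
  define c where "c = concat (map (bonacci_z m) [0..<k + 3])"
  define u where "u = hprod m k @ [k mod m]"
  have h: "rev_h m k = [k mod m] @ tl (rev_h m k)" using rev_h_Cons[OF m, of k] by simp
  have "c = z_prefix m (k + 2) @ [k mod m]"
    unfolding c_def using concat_bonacci_z[OF m, of "k + 2"]
    by (simp add: numeral_2_eq_2 numeral_3_eq_3)
  \<comment> \<open>\<open>hprod m (k + 2)\<close> ends in \<open>rev_h m k\<close> followed by
    \<open>rev_h m (Suc k)\<close>, so \<open>x\<close> occurs in \<open>c\<close> right after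
    \<open>u\<close>.\<close>
  then have c: "c = u @ x @ e @ head_block m (k + 2) @ [k mod m]"
    using y h by (simp add: z_prefix_def u_def del: rev_h_simps) (metis append.assoc append_Cons append_Nil)
  then have "c \<noteq> u" by simp
  have "card {(u, e @ head_block m (k + 2) @ [k mod m] @ x), (c, [])} \<le> occurrences x (c @ x)"
    using c by (intro card_le_occurrences) auto
  with \<open>c \<noteq> u\<close> show ?thesis unfolding c_def by auto
qed

lemma not_closed_prefix:
  assumes m: "m \<ge> 2"
    and x: "x = tl (rev_h m k) @ rev_h m (Suc k) @ e" "e \<noteq> []"
    and z: "bonacci_z m (k + 3) = x @ f" "f \<noteq> []"
  shows "\<not> closed_word x"
proof
  assume "closed_word x"
  have h: "rev_h m k = [k mod m] @ tl (rev_h m k)" using rev_h_Cons[OF m, of k] by simp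
  obtain s where s: "rev_h m (Suc k) = s @ rev_h m k"
    using suffix_rev_h[OF m, of k "Suc k"] by (auto simp: suffix_def)
  have "rev_h m (Suc k) \<noteq> []" using rev_h_Cons[OF m, of "Suc k"] by (metis list.distinct(1))
  with x have "length x \<noteq> 1" by (cases e; cases "rev_h m (Suc k)") auto
  with \<open>closed_word x\<close> obtain b where b: "border b x" "occurrences b x = 2"
    by (auto simp: closed_word_def)
  then have "b \<noteq> x" using occurrences_self[of x] by auto
  obtain v where v: "x = b @ v" using b(1) by (auto simp: border_def prefix_def)
  obtain u where u: "x = u @ b" using b(1) by (auto simp: border_def suffix_def)
  have "u \<noteq> []" "v \<noteq> []" using u v \<open>b \<noteq> x\<close> by auto
  show False
  proof (cases "length (rev_h m k) \<le> length b")
    case True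
    have len: "length (z_border m k) = length (rev_h m k)"
      by (subst h) (simp add: z_border_def slide_def)
    obtain c where "bonacci_z m (k + 3) = z_border m k @ c" using z_border_prefix[OF m] by blast
    with z v have "prefix (z_border m k) (x @ f)" "prefix b (x @ f)"
      by (metis prefixI, simp)
    with True len have "prefix (z_border m k) b" by (metis prefix_length_prefix)
    then obtain d where "b = z_border m k @ d" by (auto simp: prefix_def)
    \<comment> \<open>The suffix \<open>b\<close> yields an occurrence of
      \<open>z_border m k\<close> with both contexts nonempty.\<close>
    with z u have "bonacci_z m (k + 3) = u @ z_border m k @ (d @ f)" by simp
    with z_border_only_ends[OF m this] \<open>u \<noteq> []\<close> z(2) show False by simp
  next
    case False
    then have "length b \<le> length (tl (rev_h m k))" by simp
    moreover have "prefix b x" using v by simp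
    moreover have "prefix (tl (rev_h m k)) x" unfolding x(1) by simp
    ultimately have "prefix b (tl (rev_h m k))" by (metis prefix_length_prefix)
    then obtain d where d: "tl (rev_h m k) = b @ d" by (auto simp: prefix_def)
    \<comment> \<open>\<open>w\<close> precedes a third occurrence of \<open>b\<close>, in the copy
      of \<open>rev_h m k\<close> that ends \<open>rev_h m (Suc k)\<close>. As \<open>e\<close> is
      nonempty, this is not the suffix occurrence.\<close>
    define w where "w = b @ d @ s @ [k mod m]"
    have x': "x = w @ b @ d @ e"
      using x(1) s h d unfolding w_def by (metis append.assoc)
    have "w \<noteq> []" by (simp add: w_def)
    have "w \<noteq> u"
    proof
      assume "w = u"
      with x' u have "b @ d @ e = b" by auto
      with x(2) show False by simp
    qed
    have "card {([], v), (u, []), (w, d @ e)} \<le> occurrences b x"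
      using u v x' by (intro card_le_occurrences) auto
    with b(2) \<open>w \<noteq> []\<close> \<open>u \<noteq> []\<close> \<open>w \<noteq> u\<close> show False by simp
  qed
qed

lemma bonacci_z_minimal:
  assumes m: "m \<ge> 2" and x: "bonacci_z m (k + 3) = x @ f" "f \<noteq> []"
    and cl: "closed_word x"
  shows "occurrences x (concat (map (bonacci_z m) [0..<k + 3]) @ x) \<noteq> 1"
proof -
  let ?y = "tl (rev_h m k) @ rev_h m (Suc k)"
  have "prefix x (x @ f)" "prefix ?y (x @ f)"
    using x(1) bonacci_z_expand[OF m, of k] by (simp, metis append.assoc prefixI)
  then consider "prefix x ?y" | "strict_prefix ?y x"
    by (metis prefix_same_cases prefix_order.le_less)
  then show ?thesis
  proof cases
    case 1
    then show ?thesis using repeated_prefix[OF m] by (metis prefix_def)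
  next
    case 2
    then obtain e where "x = ?y @ e" "e \<noteq> []" by (metis strict_prefixE' list.distinct(1) append_self_conv prefix_def strict_prefix_def)
    with not_closed_prefix[OF m _ _ x, of e] cl show ?thesis by simp
  qed
qed

section \<open>The first three factors\<close>

lemma append3_Cons_conv:
  "a # w = u @ x @ v \<longleftrightarrow> u = [] \<and> a # w = x @ v \<or> (\<exists>u'. u = a # u' \<and> w = u' @ x @ v)"
  by (cases u) auto

lemma bonacci_z_small:
  assumes m: "m \<ge> 2" and n: "n < 3"
  shows "closed_word (bonacci_z m n) \<and>
      occurrences (bonacci_z m n) (concat (map (bonacci_z m) [0..<n]) @ bonacci_z m n) = 1 \<and>
      (\<forall>x f. bonacci_z m n = x @ f \<longrightarrow> f \<noteq> [] \<longrightarrow> closed_word x \<longrightarrow>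
        occurrences x (concat (map (bonacci_z m) [0..<n]) @ x) \<noteq> 1)"
proof -
  have z01: "bonacci_z m 0 = [0]" "bonacci_z m 1 = [1]" by (simp_all add: bonacci_z_def)
  have single: ?thesis if "bonacci_z m n = [n]" "n < 2"
  proof -
    have "occurrences [n] (concat (map (bonacci_z m) [0..<n]) @ [n]) = 1"
      using that z01 by (intro occurrences_eq_1I)
        (auto simp: less_2_cases_iff append3_Cons_conv Cons_eq_append_conv)
    moreover have "\<not> closed_word []" by (simp add: closed_word_def)
    ultimately show ?thesis using that(1) by (auto simp: closed_word_def Cons_eq_append_conv)
  qed
  have two: ?thesis if n: "n = 2" and z: "bonacci_z m 2 = 0 # w @ [0]" and w: "w = [] \<or> w = [2]" for w
  proof -
    have c: "concat (map (bonacci_z m) [0..<n]) = [0, 1]"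
      using z01 n by (simp add: numeral_2_eq_2)
    have "occurrences [0] (0 # w @ [0]) = 2"
      using w by (intro occurrences_eq_2I)
        (auto simp: border_def append3_Cons_conv Cons_eq_append_conv suffix_def)
    moreover have "border [0] (0 # w @ [0])"
      by (auto simp: border_def suffix_def)
    ultimately have "closed_word (0 # w @ [0])"
      by (auto simp: closed_word_def)
    moreover have "occurrences (0 # w @ [0]) ([0, 1] @ (0 # w @ [0])) = 1"
      using w by (intro occurrences_eq_1I) (auto simp: append3_Cons_conv Cons_eq_append_conv)
    moreover have "occurrences x ([0, 1] @ x) \<noteq> 1"
      if x: "0 # w @ [0] = x @ f" "f \<noteq> []" "closed_word x" for x f
    proof -
      \<comment> \<open>Among these prefixes \<open>[0]\<close> already occurs in
        \<open>[0, 1]\<close>, while \<open>[]\<close> and \<open>[0, 2]\<close> are not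
        closed.\<close>
      from x(1,2) w consider "x = []" | "x = [0]" | "x = [0, 2]"
        by (auto simp: Cons_eq_append_conv)
      then show ?thesis
      proof cases
        case 1
        with x(3) show ?thesis by (simp add: closed_word_def)
      next
        case 2
        have "card {([], [1, 0]), ([0 :: nat, 1], [] :: nat list)} \<le> occurrences x ([0, 1] @ x)"
          using 2 by (intro card_le_occurrences) auto
        then show ?thesis by simp
      next
        case 3
        with x(3) obtain b where b: "border b x" "occurrences b x = 2"
          by (auto simp: closed_word_def)
        from b(1) 3 have "b = x" by (auto simp: border_def prefix_Cons suffix_Cons)
        with b(2) occurrences_self[of x] show ?thesis by simp
      qed
    qed
    ultimately show ?thesis unfolding c using n z by simp
  qed
  consider "n = 0" | "n = 1" | "n = 2" using n by linarith
  then show ?thesis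
  proof cases
    case 3
    then show ?thesis using two[of "if m \<ge> 3 then [2] else []"] m by (auto simp: bonacci_z_def)
  qed (use single z01 in auto)
qed

theorem theorem42:
  fixes m :: nat
  assumes "m \<ge> 2"
  shows "closed_z_factorization (bonacci_word m) (bonacci_z m)"
  unfolding closed_z_factorization_def
proof (intro conjI allI)
  note m = assms
  show "bonacci_z m i \<noteq> []" for i by (rule bonacci_z_nonempty[OF m])
  show "bonacci_word m = product_from 0 (bonacci_z m)" by (rule bonacci_word_product[OF m])
  fix i
  let ?P = "concat (map (bonacci_z m) [0..<i])"
  have rec: "product_from i (bonacci_z m) = bonacci_z m i @- product_from (Suc i) (bonacci_z m)"
    by (rule product_from_rec) (rule bonacci_z_nonempty[OF m])
  have *: "closed_word (bonacci_z m i) \<and> occurrences (bonacci_z m i) (?P @ bonacci_z m i) = 1 \<and>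
      (\<forall>x f. bonacci_z m i = x @ f \<longrightarrow> f \<noteq> [] \<longrightarrow> closed_word x \<longrightarrow> occurrences x (?P @ x) \<noteq> 1)"
  proof (cases "i < 3")
    case False
    then obtain k where "i = k + 3" by (metis add.commute le_Suc_ex not_less)
    then show ?thesis
      using closed_bonacci_z[OF m] occurrences_bonacci_z[OF m] bonacci_z_minimal[OF m] by blast
  qed (rule bonacci_z_small[OF m])
  show "is_arg_min length (\<lambda>x. stream_prefix x (product_from i (bonacci_z m)) \<and> closed_word x \<and>
      occurrences x (?P @ x) = 1) (bonacci_z m i)"
    unfolding is_arg_min_def
  proof (intro conjI notI)
    show "stream_prefix (bonacci_z m i) (product_from i (bonacci_z m))"
      unfolding rec by (auto simp: stream_prefix_def)
    assume "\<exists>x. (stream_prefix x (product_from i (bonacci_z m)) \<and> closed_word x \<and>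
      occurrences x (?P @ x) = 1) \<and> length x < length (bonacci_z m i)"
    then obtain x where x: "stream_prefix x (bonacci_z m i @- product_from (Suc i) (bonacci_z m))"
        "closed_word x" "occurrences x (?P @ x) = 1" "length x < length (bonacci_z m i)"
      unfolding rec by blast
    from stream_prefix_cases[OF x(1,4)] obtain f where "bonacci_z m i = x @ f" "f \<noteq> []" by blast
    with * x(2,3) show False by blast
  qed (use * in auto)
qed

end
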